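(* Every second countable, locally convex, locally compact $T_2$-preordered $I$-space $(E,\mathscr{T},\le)$ is strictly quasi-pseudo-metrizable. (Observe that, for a second countable locally compact $T_2$-preordered space, local convexity holds whenever the space is $k$-preserving or compactly generated, and the preorder is antisymmetric.)
   Context: A topological preordered space is a triple $(E,\mathscr{T},\le)$ with $(E,\mathscr{T})$ a topological space (not assumed Hausdorff) and $\le$ a reflexive and transitive relation. Set $i(S)=\{y: x\le y \text{ for some } x\in S\}$, $d(S)=\{y: y\le x \text{ for some } x\in S\}$, $i(x)=i(\{x\})$, $d(x)=d(\{x\})$. A set $S$ is increasing if $i(S)=S$, decreasing if $d(S)=S$, and convex if it is the intersection of a decreasing and an increasing set. The space is semiclosed preordered if all $i(x)$, $d(x)$ are closed; $T_2$-preordered if the graph $G(\le)=\{(x,y):x\le y\}$ is closed in $E\times E$; an $I$-space if $d(S)$ and $i(S)$ are open for every open $S$. Locally compact means that each point has a compact neighborhood. The space is locally convex if at each $x$ the convex neighborhoods of $x$ form a base of the neighborhood system of $x$. It is convex if for every $x$ and every open neighborhood $O$ of $x$ there are an open decreasing $U$ and an open increasing $V$ with $x\in U\cap V\subset O$. A $T_2$-preordered space is $k$-preserving if $d(K)\cap i(K)$ is compact for every compact $K$. It is compactly generated if there is a relation $R\subset G(\le)$ such that (i) $\overline{R(K)}$ is compact for every compact $K$, where $R(K)=\{y:(x,y)\in R\text{ for some }x\in K\}$, and (ii) $\le$ is the smallest closed preorder containing $R$. The upper topology $\mathscr{T}^\sharp$ is the family of open increasing sets; the lower topology $\mathscr{T}^\flat$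 is the family of open decreasing sets. A quasi-pseudo-metric on $E$ is a function $p:E\times E\to[0,+\infty)$ with $p(x,x)=0$ and $p(x,z)\le p(x,y)+p(y,z)$; its conjugate is $p^{-1}(x,y)=p(y,x)$; its topology has as base the balls $\{y:p(x,y)<\epsilon\}$. $(E,\mathscr{T},\le)$ is strictly quasi-pseudo-metrizable if it is convex, semiclosed preordered, and there is a quasi-pseudo-metric $p$ such that the topology of $p$ is $\mathscr{T}^\sharp$ and the topology of $p^{-1}$ is $\mathscr{T}^\flat$. *)

theory Defs
  imports "HOL-Analysis.Analysis"
begin

text \<open>
  A topological preordered space is a pair of an abstract topology \<open>X\<close> (not assumed Hausdorff)
  and the graph \<open>r\<close> of a preorder on its carrier, i.e. \<^prop>\<open>preorder_on (topspace X) r\<close>.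
  Thus \<open>r `` S\<close> is \<open>i(S)\<close> and \<open>r\<inverse> `` S\<close> is \<open>d(S)\<close>.
\<close>

subsection \<open>Preordered sets\<close>

definition increasing_set :: "'a rel \<Rightarrow> 'a set \<Rightarrow> bool" where
  "increasing_set r S \<longleftrightarrow> r `` S = S"

definition decreasing_set :: "'a rel \<Rightarrow> 'a set \<Rightarrow> bool" where
  "decreasing_set r S \<longleftrightarrow> r\<inverse> `` S = S"

definition order_convex_set :: "'a rel \<Rightarrow> 'a set \<Rightarrow> bool" where
  "order_convex_set r S \<longleftrightarrow>
     (\<exists>D I. decreasing_set r D \<and> increasing_set r I \<and> S = D \<inter> I)"


subsection \<open>Topological preordered spaces\<close>

definition semiclosed_preordered :: "'a topology \<Rightarrow> 'a rel \<Rightarrow> bool" where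
  "semiclosed_preordered X r \<longleftrightarrow>
     (\<forall>x \<in> topspace X. closedin X (r `` {x}) \<and> closedin X (r\<inverse> `` {x}))"

definition T2_preordered :: "'a topology \<Rightarrow> 'a rel \<Rightarrow> bool" where
  "T2_preordered X r \<longleftrightarrow> closedin (prod_topology X X) r"

definition I_space :: "'a topology \<Rightarrow> 'a rel \<Rightarrow> bool" where
  "I_space X r \<longleftrightarrow> (\<forall>S. openin X S \<longrightarrow> openin X (r\<inverse> `` S) \<and> openin X (r `` S))"

text \<open>The convex neighbourhoods in the base need not be open.\<close>

definition locally_order_convex :: "'a topology \<Rightarrow> 'a rel \<Rightarrow> bool" where
  "locally_order_convex X r \<longleftrightarrow> neighbourhood_base_of (order_convex_set r) X"

definition order_convex_space :: "'a topology \<Rightarrow> 'a rel \<Rightarrow> bool" where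
  "order_convex_space X r \<longleftrightarrow>
     (\<forall>x \<in> topspace X. \<forall>W. openin X W \<and> x \<in> W \<longrightarrow>
        (\<exists>U V. openin X U \<and> decreasing_set r U \<and> openin X V \<and> increasing_set r V \<and>
               x \<in> U \<inter> V \<and> U \<inter> V \<subseteq> W))"

definition k_preserving :: "'a topology \<Rightarrow> 'a rel \<Rightarrow> bool" where
  "k_preserving X r \<longleftrightarrow> (\<forall>K. compactin X K \<longrightarrow> compactin X (r\<inverse> `` K \<inter> r `` K))"

definition is_closed_preorder :: "'a topology \<Rightarrow> 'a rel \<Rightarrow> bool" where
  "is_closed_preorder X q \<longleftrightarrow>
     preorder_on (topspace X) q \<and> closedin (prod_topology X X) q"

definition compactly_generated_preorder :: "'a topology \<Rightarrow> 'a rel \<Rightarrow> bool" where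
  "compactly_generated_preorder X r \<longleftrightarrow>
     (\<exists>R \<subseteq> r. (\<forall>K. compactin X K \<longrightarrow> compactin X (X closure_of (R `` K))) \<and>
       is_closed_preorder X r \<and>
       (\<forall>q. is_closed_preorder X q \<and> R \<subseteq> q \<longrightarrow> r \<subseteq> q))"


subsection \<open>Upper and lower topologies\<close>

definition upper_topology :: "'a topology \<Rightarrow> 'a rel \<Rightarrow> 'a topology" where
  "upper_topology X r = topology (\<lambda>U. openin X U \<and> increasing_set r U)"

definition lower_topology :: "'a topology \<Rightarrow> 'a rel \<Rightarrow> 'a topology" where
  "lower_topology X r = topology (\<lambda>U. openin X U \<and> decreasing_set r U)"

lemma increasing_set_iff:
  assumes "preorder_on A r" "S \<subseteq> A"
  shows "increasing_set r S \<longleftrightarrow> (\<forall>x\<in>S. \<forall>y. (x, y) \<in> r \<longrightarrow> y \<in> S)"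
  using assms unfolding increasing_set_def preorder_on_def refl_on_def by blast

lemma decreasing_set_iff:
  assumes "preorder_on A r" "S \<subseteq> A"
  shows "decreasing_set r S \<longleftrightarrow> (\<forall>x\<in>S. \<forall>y. (y, x) \<in> r \<longrightarrow> y \<in> S)"
  using assms unfolding decreasing_set_def preorder_on_def refl_on_def by blast

lemma openin_upper_topology:
  assumes "preorder_on (topspace X) r"
  shows "openin (upper_topology X r) U \<longleftrightarrow> openin X U \<and> increasing_set r U"
proof -
  have iff: "openin X U \<and> increasing_set r U \<longleftrightarrow>
      openin X U \<and> (\<forall>x\<in>U. \<forall>y. (x, y) \<in> r \<longrightarrow> y \<in> U)" for U
    using increasing_set_iff[OF assms openin_subset] by blast
  have "istopology (\<lambda>U. openin X U \<and> increasing_set r U)"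
    unfolding iff istopology_def by blast
  then show ?thesis
    by (simp add: upper_topology_def topology_inverse')
qed

lemma openin_lower_topology:
  assumes "preorder_on (topspace X) r"
  shows "openin (lower_topology X r) U \<longleftrightarrow> openin X U \<and> decreasing_set r U"
proof -
  have iff: "openin X U \<and> decreasing_set r U \<longleftrightarrow>
      openin X U \<and> (\<forall>x\<in>U. \<forall>y. (y, x) \<in> r \<longrightarrow> y \<in> U)" for U
    using decreasing_set_iff[OF assms openin_subset] by blast
  have "istopology (\<lambda>U. openin X U \<and> decreasing_set r U)"
    unfolding iff istopology_def by blast
  then show ?thesis
    by (simp add: lower_topology_def topology_inverse')
qed


subsection \<open>Quasi-pseudo-metrics\<close>

definition quasi_pseudo_metric_on :: "'a set \<Rightarrow> ('a \<Rightarrow> 'a \<Rightarrow> real) \<Rightarrow> bool" where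
  "quasi_pseudo_metric_on A p \<longleftrightarrow>
     (\<forall>x\<in>A. \<forall>y\<in>A. 0 \<le> p x y) \<and> (\<forall>x\<in>A. p x x = 0) \<and>
     (\<forall>x\<in>A. \<forall>y\<in>A. \<forall>z\<in>A. p x z \<le> p x y + p y z)"

definition qpm_conjugate :: "('a \<Rightarrow> 'a \<Rightarrow> real) \<Rightarrow> 'a \<Rightarrow> 'a \<Rightarrow> real" where
  "qpm_conjugate p = (\<lambda>x y. p y x)"

definition qpm_ball :: "'a set \<Rightarrow> ('a \<Rightarrow> 'a \<Rightarrow> real) \<Rightarrow> 'a \<Rightarrow> real \<Rightarrow> 'a set" where
  "qpm_ball A p x e = {y \<in> A. p x y < e}"

definition qpm_topology :: "'a set \<Rightarrow> ('a \<Rightarrow> 'a \<Rightarrow> real) \<Rightarrow> 'a topology" where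
  "qpm_topology A p =
     topology (arbitrary union_of (\<lambda>B. \<exists>x\<in>A. \<exists>e>0. B = qpm_ball A p x e))"

lemma quasi_pseudo_metric_on_conjugate:
  "quasi_pseudo_metric_on A p \<Longrightarrow> quasi_pseudo_metric_on A (qpm_conjugate p)"
  unfolding quasi_pseudo_metric_on_def qpm_conjugate_def by (metis add.commute)

lemma openin_qpm_topology:
  assumes p: "quasi_pseudo_metric_on A p"
  shows "openin (qpm_topology A p) =
           arbitrary union_of (\<lambda>B. \<exists>x\<in>A. \<exists>e>0. B = qpm_ball A p x e)"
proof -
  let ?P = "\<lambda>B. \<exists>x\<in>A. \<exists>e>0. B = qpm_ball A p x e"
  have small: "\<exists>e>0. qpm_ball A p z e \<subseteq> B" if "?P B" "z \<in> B" for B z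
  proof -
    obtain x d where x: "x \<in> A" "B = qpm_ball A p x d"
      using \<open>?P B\<close> by blast
    then have z: "z \<in> A" "p x z < d"
      using \<open>z \<in> B\<close> by (auto simp: qpm_ball_def)
    have "qpm_ball A p z (d - p x z) \<subseteq> B"
    proof
      fix y assume "y \<in> qpm_ball A p z (d - p x z)"
      then have y: "y \<in> A" "p z y < d - p x z"
        by (auto simp: qpm_ball_def)
      have "p x y \<le> p x z + p z y"
        using p x z y unfolding quasi_pseudo_metric_on_def by blast
      then show "y \<in> B"
        using x y by (auto simp: qpm_ball_def)
    qed
    then show ?thesis
      using z by (intro exI[of _ "d - p x z"]) auto
  qed
  have "(arbitrary union_of ?P) (S \<inter> T)" if S: "?P S" and T: "?P T" for S T
    unfolding arbitrary_union_of_alt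
  proof
    fix z assume z: "z \<in> S \<inter> T"
    obtain d e where de: "d > 0" "qpm_ball A p z d \<subseteq> S" "e > 0" "qpm_ball A p z e \<subseteq> T"
      using small[OF S, of z] small[OF T, of z] z by auto
    have zA: "z \<in> A"
      using S z by (auto simp: qpm_ball_def)
    then have "p z z = 0"
      using p unfolding quasi_pseudo_metric_on_def by blast
    then have "z \<in> qpm_ball A p z (min d e)" "qpm_ball A p z (min d e) \<subseteq> S \<inter> T"
      using zA de by (auto simp: qpm_ball_def)
    moreover have "?P (qpm_ball A p z (min d e))"
      using zA de by (intro bexI[of _ z] exI[of _ "min d e"]) auto
    ultimately show "\<exists>U. ?P U \<and> z \<in> U \<and> U \<subseteq> S \<inter> T"
      by (intro exI[of _ "qpm_ball A p z (min d e)"]) blast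
  qed
  then have "istopology (arbitrary union_of ?P)"
    by (simp add: istopology_base_eq)
  then show ?thesis
    by (simp add: qpm_topology_def topology_inverse')
qed

definition strictly_quasi_pseudo_metrizable :: "'a topology \<Rightarrow> 'a rel \<Rightarrow> bool" where
  "strictly_quasi_pseudo_metrizable X r \<longleftrightarrow>
     order_convex_space X r \<and> semiclosed_preordered X r \<and>
     (\<exists>p. quasi_pseudo_metric_on (topspace X) p \<and>
          qpm_topology (topspace X) p = upper_topology X r \<and>
          qpm_topology (topspace X) (qpm_conjugate p) = lower_topology X r)"

end

theory Submission
  imports Defs
begin

text \<open>
  Write \<open>i(S) = r `` S\<close> and \<open>d(S) = r\<inverse> `` S\<close>.  Everything rests on two consequences of
  the closed graph for a compact set \<open>C\<close>: the sets \<open>i(C)\<close> and \<open>d(C)\<close> are closed, and so is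
  the relation \<open>r O Id_on C O r\<close> of the pairs \<open>p \<le> q\<close> that have some \<open>b \<in> C\<close> between them.

  \<^bold>\<open>Metrizability.\<close>  In an \<open>I\<close>-space, hulls \<open>i(P)\<close> and \<open>d(P)\<close> of open sets are open, so the
  convex neighbourhoods granted by local convexity can be replaced by \<open>d(P) \<inter> i(P)\<close>; this is the
  convexity of the space.  Moreover, inside an open increasing set every point has a compact
  neighbourhood \<open>N\<close>, and \<open>i(N)\<close> is then a closed increasing neighbourhood; the same for decreasing
  sets and intersection give the regularity of the topology, which with local compactness yields
  complete regularity.  So a point \<open>x\<close> of an open increasing set \<open>V\<close> carries a continuous bump \<open>h\<close>,
  vanishing outside \<open>V\<close> and outside a compact set.  Its isotone envelope \<open>f y = Sup {h z | z \<le> y}\<close> is still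
  continuous: \<open>{f > a} = i({h > a})\<close> is open because of the \<open>I\<close>-property, and
  \<open>{f \<ge> a}\<close> is an intersection of the sets \<open>i({h \<ge> b})\<close> with \<open>0 < b < a\<close>, which are closed because
  \<open>{h \<ge> b}\<close> is compact.  Second countability reduces these functions to a sequence \<open>f\<^sub>0, f\<^sub>1, \<dots>\<close> of
  utilities (\<open>countable_separating_utilities\<close>), which, together with the
  reflected utilities of the opposite preorder, separates points from the complements of open
  increasing sets and of open decreasing sets.  The asymmetric distance
  \<open>p x y = sup\<^sub>n 2\<^sup>-\<^sup>n max 0 (f\<^sub>n x - f\<^sub>n y)\<close> then generates the upper topology, and its conjugate
  generates the lower one.

  \<^bold>\<open>Local convexity.\<close>  Suppose the preorder is antisymmetric, and \<open>x\<close> lies in an open \<open>W\<close>.  If \<open>C\<close>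
  is a compact set without \<open>x\<close>, antisymmetry says that \<open>(x, x)\<close> is not in the closed relation
  \<open>r O Id_on C O r\<close>, so no chain between two points of a suitable neighbourhood of \<open>x\<close> passes through
  \<open>C\<close>.  It remains to find \<open>C\<close> such that all chains that start and end near \<open>x\<close> but leave \<open>W\<close> must
  meet \<open>C\<close>.  For a \<open>k\<close>-preserving preorder, \<open>(d(K) \<inter> i(K)) - W\<close> serves, where \<open>K\<close> is a compact
  neighbourhood of \<open>x\<close>.  For a compactly generated one, take an open \<open>V\<close> with
  \<open>x \<in> V \<subseteq> K \<subseteq> W\<close> and the shell of points outside \<open>V\<close> that are in \<open>K\<close> or in the closure of \<open>R(K)\<close>:
  a single step of \<open>R\<close> that leaves \<open>V\<close> lands there, and by minimality of the preorder every
  relation \<open>p \<le> q\<close> that leaves \<open>V\<close> passes through it (\<open>compactly_generated_chain_through_shell\<close>).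
\<close>

section \<open>Closed preorders and compact sets\<close>

lemma preorder_on_converse: "preorder_on A (r\<inverse>) \<longleftrightarrow> preorder_on A r"
proof -
  have "r\<inverse> \<subseteq> A \<times> A \<longleftrightarrow> r \<subseteq> A \<times> A"
    by auto
  then show ?thesis
    by (simp add: preorder_on_def refl_on_def)
qed

lemma preorder_onD:
  assumes "preorder_on A r"
  shows "r \<subseteq> A \<times> A" "x \<in> A \<Longrightarrow> (x, x) \<in> r" "(x, y) \<in> r \<Longrightarrow> (y, z) \<in> r \<Longrightarrow> (x, z) \<in> r"
  using assms by (auto simp: preorder_on_def refl_on_def dest: transD)

lemma preorder_on_subset_Image:
  assumes "preorder_on A r" "S \<subseteq> A"
  shows "S \<subseteq> r `` S" "r `` S \<subseteq> A"
  using preorder_onD[OF assms(1)] assms(2) by blast+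

lemma increasing_set_Image:
  assumes "preorder_on A r"
  shows "increasing_set r (r `` S)"
  unfolding increasing_set_def using preorder_onD[OF assms] by blast

lemma decreasing_set_eq_increasing_converse: "decreasing_set r = increasing_set (r\<inverse>)"
  by (simp add: fun_eq_iff decreasing_set_def increasing_set_def)

lemma order_convex_set_dec_Int_inc:
  assumes "preorder_on A r"
  shows "order_convex_set r (r\<inverse> `` S \<inter> r `` S)"
  unfolding order_convex_set_def decreasing_set_eq_increasing_converse
  using assms increasing_set_Image preorder_on_converse by blast

lemma order_convex_set_hull_subset:
  assumes "order_convex_set r C" "P \<subseteq> C"
  shows "r\<inverse> `` P \<inter> r `` P \<subseteq> C"
  using assms unfolding order_convex_set_def decreasing_set_def increasing_set_def by blast

lemma T2_preordered_converse:
  assumes "T2_preordered X r"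
  shows "T2_preordered X (r\<inverse>)"
proof -
  have "r\<inverse> = (\<lambda>(x, y). (y, x)) ` r"
    by force
  then show ?thesis
    using assms homeomorphic_imp_closed_map[OF homeomorphic_map_swap, of X X]
    by (simp add: T2_preordered_def closed_map_def)
qed

lemma T2_preordered_openin_Diff:
  assumes "T2_preordered X r"
  shows "openin (prod_topology X X) (topspace X \<times> topspace X - r)"
  using openin_diff[OF openin_topspace assms[unfolded T2_preordered_def]] by simp

lemma closedin_Image_compactin:
  assumes r: "preorder_on (topspace X) r" "T2_preordered X r" and K: "compactin X K"
  shows "closedin X (r `` K)"
proof -
  have "\<exists>V. openin X V \<and> y \<in> V \<and> V \<subseteq> topspace X - r `` K" if y: "y \<in> topspace X - r `` K" for y
  proof -
    have yE: "y \<in> topspace X"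
      using y by simp
    have sub: "K \<times> {y} \<subseteq> topspace X \<times> topspace X - r"
      using y compactin_subset_topspace[OF K] by auto
    obtain U V where "openin X V" "K \<subseteq> U" "y \<in> V" "U \<times> V \<subseteq> topspace X \<times> topspace X - r"
      using tube_lemma_left[OF T2_preordered_openin_Diff[OF r(2)] K yE sub] by auto
    then show ?thesis
      by (intro exI[of _ V]) (auto dest: openin_subset)
  qed
  then have "openin X (topspace X - r `` K)"
    by (subst openin_subopen) blast
  then show ?thesis
    using preorder_on_subset_Image(2)[OF r(1) compactin_subset_topspace[OF K]]
    by (simp add: closedin_def)
qed

text \<open>
  The relation \<open>r O Id_on C O r\<close> consists of the pairs that are joined by a chain through \<open>C\<close>.  It
  is a projection along \<open>C\<close> of a closed set of triples, which is why compactness of \<open>C\<close> makes it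
  closed.
\<close>

lemma closedin_relcomp_through_compactin:
  assumes r: "preorder_on (topspace X) r" "T2_preordered X r" and C: "compactin X C"
  shows "closedin (prod_topology X X) (r O Id_on C O r)"
proof -
  let ?XX = "prod_topology X X" and ?G = "topspace X \<times> topspace X - r"
  let ?L = "{z \<in> topspace (prod_topology ?XX X). (fst (fst z), snd z) \<in> ?G}"
  let ?R = "{z \<in> topspace (prod_topology ?XX X). (snd z, snd (fst z)) \<in> ?G}"
  have G: "openin ?XX ?G"
    by (rule T2_preordered_openin_Diff[OF r(2)])
  have fst_fst: "continuous_map (prod_topology ?XX X) X (\<lambda>z. fst (fst z))"
    using continuous_map_compose[OF continuous_map_fst continuous_map_fst] by (simp add: o_def)
  have snd_fst: "continuous_map (prod_topology ?XX X) X (\<lambda>z. snd (fst z))"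
    using continuous_map_compose[OF continuous_map_fst continuous_map_snd] by (simp add: o_def)
  have "openin (prod_topology ?XX X) ?L" "openin (prod_topology ?XX X) ?R"
    by (intro openin_continuous_map_preimage[OF _ G] continuous_map_pairedI
        fst_fst snd_fst continuous_map_snd)+
  then have W: "openin (prod_topology ?XX X) (?L \<union> ?R)"
    by (rule openin_Un)
  have "\<exists>U. openin ?XX U \<and> z \<in> U \<and> U \<subseteq> topspace ?XX - r O Id_on C O r"
    if z: "z \<in> topspace ?XX - r O Id_on C O r" for z
  proof -
    have zE: "z \<in> topspace ?XX"
      using z by simp
    have sub: "{z} \<times> C \<subseteq> ?L \<union> ?R"
      using z compactin_subset_topspace[OF C] by (fastforce simp: relcomp_unfold)
    obtain U V where UV: "openin ?XX U" "z \<in> U" "C \<subseteq> V" "U \<times> V \<subseteq> ?L \<union> ?R"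
      using tube_lemma_right[OF W C zE sub] by auto
    then have "U \<subseteq> topspace ?XX"
      using openin_subset by blast
    with UV have "U \<subseteq> topspace ?XX - r O Id_on C O r"
      by fastforce
    with UV show ?thesis
      by blast
  qed
  then have "openin ?XX (topspace ?XX - r O Id_on C O r)"
    by (subst openin_subopen) blast
  moreover have "r O Id_on C O r \<subseteq> topspace ?XX"
    using preorder_onD(1)[OF r(1)] by auto
  ultimately show ?thesis
    by (simp add: closedin_def)
qed

lemma T2_preordered_imp_semiclosed:
  assumes "preorder_on (topspace X) r" "T2_preordered X r"
  shows "semiclosed_preordered X r"
  unfolding semiclosed_preordered_def
  using assms preorder_on_converse T2_preordered_converse
  by (blast intro: closedin_Image_compactin compactin_sing[THEN iffD2])


section \<open>Local convexity of ordered spaces\<close>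

lemma antisym_T2_preordered_imp_Hausdorff:
  assumes "preorder_on (topspace X) r" "T2_preordered X r" "antisym r"
  shows "Hausdorff_space X"
proof -
  have *: "\<exists>U V. openin X U \<and> openin X V \<and> x \<in> U \<and> y \<in> V \<and> disjnt U V"
    if "x \<in> topspace X" "y \<in> topspace X" "(x, y) \<notin> r" for x y
  proof -
    have "(x, y) \<in> topspace X \<times> topspace X - r"
      using that by simp
    then obtain U V where UV: "openin X U" "openin X V" "x \<in> U" "y \<in> V"
        "U \<times> V \<subseteq> topspace X \<times> topspace X - r"
      using T2_preordered_openin_Diff[OF assms(2)] by (metis openin_prod_topology_alt)
    then have "disjnt U V"
      using preorder_onD(2)[OF assms(1)] openin_subset unfolding disjnt_iff by blast
    with UV show ?thesis
      by blast
  qed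
  show ?thesis
    unfolding Hausdorff_space_def
  proof clarify
    fix x y assume xy: "x \<in> topspace X" "y \<in> topspace X" "x \<noteq> y"
    then consider "(x, y) \<notin> r" | "(y, x) \<notin> r"
      using assms(3) by (auto dest: antisymD)
    then show "\<exists>U V. openin X U \<and> openin X V \<and> x \<in> U \<and> y \<in> V \<and> disjnt U V"
      using *[of x y] *[of y x] xy by cases (blast, metis disjnt_sym)
  qed
qed

text \<open>
  A point \<open>b \<in> C\<close> with \<open>x \<le> b \<le> x\<close> would be \<open>x\<close> itself, so \<open>(x, x)\<close> lies outside a closed relation.
\<close>

lemma openin_no_chain_through_compactin:
  assumes r: "preorder_on (topspace X) r" "T2_preordered X r" "antisym r"
    and C: "compactin X C" and x: "x \<in> topspace X - C"
  obtains A where "openin X A" "x \<in> A" "A \<times> A \<inter> r O Id_on C O r = {}"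
proof -
  have xx: "(x, x) \<in> topspace X \<times> topspace X - r O Id_on C O r"
    using x r(3) by (auto dest: antisymD)
  have "openin (prod_topology X X) (topspace X \<times> topspace X - r O Id_on C O r)"
    using openin_diff[OF openin_topspace closedin_relcomp_through_compactin[OF r(1,2) C]] by simp
  then obtain U V where "openin X U" "openin X V" "x \<in> U" "x \<in> V"
      "U \<times> V \<subseteq> topspace X \<times> topspace X - r O Id_on C O r"
    using xx by (metis openin_prod_topology_alt)
  then show thesis
    by (intro that[of "U \<inter> V"]) auto
qed

lemma locally_order_convexI:
  assumes "preorder_on (topspace X) r"
    and "\<And>W x. openin X W \<Longrightarrow> x \<in> W \<Longrightarrow>
           \<exists>A. openin X A \<and> x \<in> A \<and> r\<inverse> `` A \<inter> r `` A \<subseteq> W"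
  shows "locally_order_convex X r"
  unfolding locally_order_convex_def neighbourhood_base_of
proof clarify
  fix W x assume Wx: "openin X W" "x \<in> W"
  obtain A where A: "openin X A" "x \<in> A" "r\<inverse> `` A \<inter> r `` A \<subseteq> W"
    using assms(2)[OF Wx] by blast
  have "A \<subseteq> r\<inverse> `` A \<inter> r `` A"
    using openin_subset[OF A(1)] preorder_onD(2)[OF assms(1)] by blast
  with A show "\<exists>U V. openin X U \<and> order_convex_set r V \<and> x \<in> U \<and> U \<subseteq> V \<and> V \<subseteq> W"
    using order_convex_set_dec_Int_inc[OF assms(1)] by blast
qed

text \<open>
  Whatever lies between two points of a compact neighbourhood \<open>K\<close> is in the compact set
  \<open>d(K) \<inter> i(K)\<close>, so chains that leave \<open>W\<close> do so through its compact part outside \<open>W\<close>.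
\<close>

lemma k_preserving_imp_locally_order_convex:
  assumes r: "preorder_on (topspace X) r" "T2_preordered X r" "antisym r"
    and lc: "locally_compact_space X" and k: "k_preserving X r"
  shows "locally_order_convex X r"
proof (rule locally_order_convexI[OF r(1)])
  fix W x assume W: "openin X W" "x \<in> W"
  then have x: "x \<in> topspace X"
    using openin_subset by blast
  then obtain U K where K: "openin X U" "compactin X K" "x \<in> U" "U \<subseteq> K"
    using lc unfolding locally_compact_space_def by blast
  define C where "C = (r\<inverse> `` K \<inter> r `` K) \<inter> (topspace X - W)"
  have "compactin X C"
    unfolding C_def
    by (rule compact_Int_closedin[OF k[unfolded k_preserving_def, rule_format, OF K(2)]
          closedin_diff[OF closedin_topspace W(1)]])
  then obtain A where A: "openin X A" "x \<in> A" "A \<times> A \<inter> r O Id_on C O r = {}"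
    using openin_no_chain_through_compactin[OF r, of C x] x W(2) unfolding C_def by blast
  have "r\<inverse> `` (A \<inter> U) \<inter> r `` (A \<inter> U) \<subseteq> W"
  proof
    fix z assume z: "z \<in> r\<inverse> `` (A \<inter> U) \<inter> r `` (A \<inter> U)"
    then have "z \<notin> C"
      using A(3) by fastforce
    with z K(4) preorder_onD(1)[OF r(1)] show "z \<in> W"
      unfolding C_def by blast
  qed
  with A K show "\<exists>A. openin X A \<and> x \<in> A \<and> r\<inverse> `` A \<inter> r `` A \<subseteq> W"
    by (intro exI[of _ "A \<inter> U"]) auto
qed

text \<open>
  The relation \<open>r\<close> is too indirectly given by \<open>R\<close> to follow a chain step by step, so minimality is used
  instead: the pairs of \<open>r\<close> with the asserted property contain \<open>R\<close> and form a closed preorder.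
  Taken literally, the condition that \<open>p \<in> V\<close> and \<open>q \<notin> V\<close> imply the existence of a point between
  them does not visibly define a closed set of pairs, as \<open>q \<in> V\<close> is an open condition.  But
  a point of \<open>K - V\<close> belongs to the shell \<open>C\<close> and is its own intermediate point, so \<open>q \<in> V\<close> can be relaxed to the
  closed condition \<open>q \<in> K\<close>.
\<close>

lemma compactly_generated_chain_through_shell:
  assumes r: "preorder_on (topspace X) r" "T2_preordered X r"
    and R: "R \<subseteq> r"
    and least: "\<And>q. is_closed_preorder X q \<Longrightarrow> R \<subseteq> q \<Longrightarrow> r \<subseteq> q"
    and V: "openin X V" "V \<subseteq> K" and K: "compactin X K" "closedin X K"
    and RK: "compactin X (X closure_of (R `` K))"
  defines "C \<equiv> (K \<union> X closure_of (R `` K)) \<inter> (topspace X - V)"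
  shows "compactin X C" "\<And>p q. (p, q) \<in> r \<Longrightarrow> p \<in> V \<Longrightarrow> q \<notin> V \<Longrightarrow> (p, q) \<in> r O Id_on C O r"
proof -
  let ?E = "topspace X" and ?T = "r O Id_on C O r"
  note pre = preorder_onD[OF r(1)]
  show C: "compactin X C"
    unfolding C_def using K(1) RK V(1) by (intro compact_Int_closedin compactin_Un) auto
  have through: "(p, q) \<in> ?T" if "(p, b) \<in> r" "(b, q) \<in> r" "b \<in> C" for p b q
    using that by auto
  have exit: "q \<in> C" if "q \<in> K" "q \<notin> V" for q
    using that compactin_subset_topspace[OF K(1)] unfolding C_def by blast
  \<comment> \<open>The pairs satisfying the claim, with \<open>q \<in> K\<close> as the closed substitute for \<open>q \<in> V\<close>.\<close>
  define S where "S = r \<inter> ((?E - V) \<times> ?E \<union> ?E \<times> K \<union> ?T)"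
  have "R \<subseteq> S"
  proof clarify
    fix p q assume pq: "(p, q) \<in> R"
    then have pqr: "(p, q) \<in> r" "p \<in> ?E" "q \<in> ?E"
      using R pre(1) by auto
    show "(p, q) \<in> S"
    proof (cases "p \<in> V \<and> q \<notin> K")
      case True
      have "R `` K \<subseteq> ?E"
        using R pre(1) by blast
      then have "q \<in> X closure_of (R `` K)"
        using pq True V(2) closure_of_subset by blast
      then have "q \<in> C"
        using True V(2) pqr unfolding C_def by blast
      then show ?thesis
        using pqr pre(2) through[of p q q] unfolding S_def by blast
    qed (use pqr in \<open>auto simp: S_def\<close>)
  qed
  moreover have "is_closed_preorder X S"
    unfolding is_closed_preorder_def
  proof
    have "(p, s) \<in> S" if pq: "(p, q) \<in> S" and qs: "(q, s) \<in> S" for p q s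
    proof -
      have rs: "(p, q) \<in> r" "(q, s) \<in> r" "(p, s) \<in> r" "p \<in> ?E" "q \<in> ?E" "s \<in> ?E"
        using that pre unfolding S_def by blast+
      have "(p, s) \<in> ?T" if ps: "p \<in> V" "s \<notin> K"
      proof (cases "q \<in> V")
        case True
        then have "(q, s) \<in> ?T"
          using qs ps unfolding S_def by blast
        then show ?thesis
          using rs(1) pre(3) by blast
      next
        case q: False
        show ?thesis
        proof (cases "q \<in> K")
          case True
          then show ?thesis
            using exit q through rs by blast
        next
          case False
          then have "(p, q) \<in> ?T"
            using pq ps unfolding S_def by blast
          then show ?thesis
            using rs(2) pre(3) by blast
        qed
      qed
      with rs show ?thesis
        unfolding S_def by blast
    qed
    moreover have "(x, x) \<in> S" if "x \<in> ?E" for x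
      using that pre(2) V(2) unfolding S_def by blast
    moreover have "S \<subseteq> ?E \<times> ?E"
      using pre(1) unfolding S_def by blast
    ultimately show "preorder_on ?E S"
      unfolding preorder_on_def refl_on_def trans_def by blast
    have "closedin (prod_topology X X) ((?E - V) \<times> ?E)" "closedin (prod_topology X X) (?E \<times> K)"
      using V(1) K(2) by (auto simp: closedin_prod_Times_iff)
    moreover have "closedin (prod_topology X X) r"
      using r(2) by (simp add: T2_preordered_def)
    ultimately show "closedin (prod_topology X X) S"
      unfolding S_def
      by (intro closedin_Int closedin_Un closedin_relcomp_through_compactin[OF r C])
  qed
  ultimately have "r \<subseteq> S"
    using least by blast
  then show "(p, q) \<in> ?T" if "(p, q) \<in> r" "p \<in> V" "q \<notin> V" for p q
    using that exit[of q] through[of p q q] pre(1,2) unfolding S_def by blast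
qed

lemma compactly_generated_imp_locally_order_convex:
  assumes r: "preorder_on (topspace X) r" "T2_preordered X r" "antisym r"
    and lc: "locally_compact_space X" and cg: "compactly_generated_preorder X r"
  shows "locally_order_convex X r"
proof (rule locally_order_convexI[OF r(1)])
  fix W x assume W: "openin X W" "x \<in> W"
  then have x: "x \<in> topspace X"
    using openin_subset by blast
  have "neighbourhood_base_of (\<lambda>C. compactin X C \<and> closedin X C) X"
    using lc antisym_T2_preordered_imp_Hausdorff[OF r] locally_compact_Hausdorff_imp_regular_space
      locally_compact_regular_space_neighbourhood_base by blast
  then obtain V K where V: "openin X V" "x \<in> V" "V \<subseteq> K" "K \<subseteq> W"
    and K: "compactin X K" "closedin X K"
    using W by (metis (no_types, lifting) neighbourhood_base_of)
  obtain R where R: "R \<subseteq> r" "\<And>K. compactin X K \<Longrightarrow> compactin X (X closure_of (R `` K))"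
      "\<And>q. is_closed_preorder X q \<Longrightarrow> R \<subseteq> q \<Longrightarrow> r \<subseteq> q"
    using cg unfolding compactly_generated_preorder_def by metis
  define C where "C = (K \<union> X closure_of (R `` K)) \<inter> (topspace X - V)"
  have C: "compactin X C" "\<And>p q. (p, q) \<in> r \<Longrightarrow> p \<in> V \<Longrightarrow> q \<notin> V \<Longrightarrow> (p, q) \<in> r O Id_on C O r"
    unfolding C_def
    using compactly_generated_chain_through_shell[OF r(1,2) R(1,3) V(1,3) K R(2)[OF K(1)]] by blast+
  obtain A where A: "openin X A" "x \<in> A" "A \<times> A \<inter> r O Id_on C O r = {}"
    using openin_no_chain_through_compactin[OF r C(1)] x V(2) unfolding C_def by blast
  have "r\<inverse> `` (A \<inter> V) \<inter> r `` (A \<inter> V) \<subseteq> V"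
  proof (rule ccontr)
    assume "\<not> ?thesis"
    then obtain p z q where pzq: "p \<in> A \<inter> V" "q \<in> A \<inter> V" "(p, z) \<in> r" "(z, q) \<in> r" "z \<notin> V"
      by blast
    then have "(p, z) \<in> r O Id_on C O r"
      using C(2) by blast
    then have "(p, q) \<in> r O Id_on C O r"
      using pzq(4) preorder_onD(3)[OF r(1)] by blast
    then show False
      using A(3) pzq by blast
  qed
  then have "r\<inverse> `` (A \<inter> V) \<inter> r `` (A \<inter> V) \<subseteq> W"
    using V(3,4) by (meson subset_trans)
  with A V show "\<exists>A. openin X A \<and> x \<in> A \<and> r\<inverse> `` A \<inter> r `` A \<subseteq> W"
    by (metis IntI openin_Int)
qed


section \<open>Continuous utilities\<close>

definition utility_on :: "'a topology \<Rightarrow> 'a rel \<Rightarrow> ('a \<Rightarrow> real) \<Rightarrow> bool" where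
  "utility_on X r f \<longleftrightarrow>
     continuous_map X (top_of_set {0..1}) f \<and> (\<forall>(x, y) \<in> r. f x \<le> f y)"

lemma utility_on_range: "utility_on X r f \<Longrightarrow> x \<in> topspace X \<Longrightarrow> 0 \<le> f x \<and> f x \<le> 1"
  by (force simp: utility_on_def continuous_map_in_subtopology)

lemma openin_utility_gt: "utility_on X r f \<Longrightarrow> openin X {x \<in> topspace X. f x > a}"
  by (simp add: utility_on_def continuous_map_upper_lower_semicontinuous_lt_gen)

lemma utility_on_reflect:
  assumes "utility_on X r f"
  shows "utility_on X (r\<inverse>) (\<lambda>x. 1 - f x)"
  using assms
  by (auto simp: utility_on_def continuous_map_in_subtopology intro!: continuous_intros)

text \<open>
  For a compact neighbourhood \<open>K\<close> of \<open>x\<close>, no point of the compact set \<open>K - V\<close> is above \<open>x\<close>.  By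
  closedness of the graph there are neighbourhoods \<open>A\<close> of \<open>x\<close> and \<open>B\<close> of \<open>K - V\<close> such that no point of \<open>A\<close>
  is below a point of \<open>B\<close>; in particular they are disjoint, and \<open>K - B\<close> is the desired neighbourhood.
\<close>

lemma increasing_compact_neighbourhood:
  assumes r: "preorder_on (topspace X) r" "T2_preordered X r" and lc: "locally_compact_space X"
    and V: "openin X V" "increasing_set r V" and x: "x \<in> V"
  obtains U N where "openin X U" "compactin X N" "x \<in> U" "U \<subseteq> N" "N \<subseteq> V"
proof -
  have xE: "x \<in> topspace X"
    using openin_subset[OF V(1)] x by blast
  then obtain W K where K: "openin X W" "compactin X K" "x \<in> W" "W \<subseteq> K"
    using lc unfolding locally_compact_space_def by metis
  have KV: "compactin X (K \<inter> (topspace X - V))"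
    by (rule compact_Int_closedin[OF K(2) closedin_diff[OF closedin_topspace V(1)]])
  have sub: "{x} \<times> (K \<inter> (topspace X - V)) \<subseteq> topspace X \<times> topspace X - r"
    using xE x V(2) unfolding increasing_set_def by blast
  obtain A B where AB: "openin X A" "openin X B" "x \<in> A" "K \<inter> (topspace X - V) \<subseteq> B"
      "A \<times> B \<subseteq> topspace X \<times> topspace X - r"
    using tube_lemma_right[OF T2_preordered_openin_Diff[OF r(2)] KV xE sub] by auto
  have "compactin X (K \<inter> (topspace X - B))"
    by (rule compact_Int_closedin[OF K(2) closedin_diff[OF closedin_topspace AB(2)]])
  moreover have "W \<inter> A \<subseteq> K \<inter> (topspace X - B)"
    using K(4) openin_subset[OF AB(1)] AB(5) preorder_onD(2)[OF r(1)] by blast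
  moreover have "K \<inter> (topspace X - B) \<subseteq> V"
    using AB(4) by blast
  ultimately show thesis
    using that openin_Int[OF K(1) AB(1)] K(3) AB(3) by blast
qed

text \<open>
  A convex set contains \<open>d(P) \<inter> i(P)\<close> for each of its subsets \<open>P\<close>; applied to the interior of a convex
  neighbourhood, this makes both factors open.
\<close>

lemma locally_order_convex_I_space_hull:
  assumes r: "preorder_on (topspace X) r" and I: "I_space X r" and lc: "locally_order_convex X r"
    and W: "openin X W" "x \<in> W"
  obtains P where "openin X (r\<inverse> `` P)" "openin X (r `` P)"
    "x \<in> r\<inverse> `` P" "x \<in> r `` P" "r\<inverse> `` P \<inter> r `` P \<subseteq> W"
proof -
  obtain P C where P: "openin X P" "order_convex_set r C" "x \<in> P" "P \<subseteq> C" "C \<subseteq> W"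
    using lc W unfolding locally_order_convex_def by (metis (no_types, lifting) neighbourhood_base_of)
  have "(x, x) \<in> r"
    using openin_subset[OF P(1)] P(3) preorder_onD(2)[OF r] by blast
  then have "x \<in> r\<inverse> `` P" "x \<in> r `` P"
    using P(3) by blast+
  moreover have "r\<inverse> `` P \<inter> r `` P \<subseteq> W"
    using order_convex_set_hull_subset[OF P(2,4)] P(5) by (rule subset_trans)
  ultimately show thesis
    using that P(1) I unfolding I_space_def by metis
qed

lemma I_space_imp_order_convex_space:
  assumes r: "preorder_on (topspace X) r" and I: "I_space X r" and lc: "locally_order_convex X r"
  shows "order_convex_space X r"
  unfolding order_convex_space_def
proof (intro ballI allI impI)
  fix x W assume W: "openin X W \<and> x \<in> W"
  obtain P where "openin X (r\<inverse> `` P)" "openin X (r `` P)" "x \<in> r\<inverse> `` P" "x \<in> r `` P"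
      "r\<inverse> `` P \<inter> r `` P \<subseteq> W"
    using locally_order_convex_I_space_hull[OF r I lc] W by metis
  moreover have "decreasing_set r (r\<inverse> `` P)" "increasing_set r (r `` P)"
    using increasing_set_Image r preorder_on_converse
    unfolding decreasing_set_eq_increasing_converse by metis+
  ultimately show "\<exists>U V. openin X U \<and> decreasing_set r U \<and> openin X V \<and> increasing_set r V \<and>
      x \<in> U \<inter> V \<and> U \<inter> V \<subseteq> W"
    by (intro exI[of _ "r\<inverse> `` P"] exI[of _ "r `` P"]) simp
qed

text \<open>
  In a locally convex space equivalent points of the preorder cannot be separated, so the space need not be Hausdorff and compact
  neighbourhoods need not be closed; their hulls are.  Hence \<open>d(M) \<inter> i(N)\<close> with compact \<open>M\<close> and
  \<open>N\<close> provides the closed neighbourhoods.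
\<close>

lemma I_space_imp_regular_space:
  assumes r: "preorder_on (topspace X) r" "T2_preordered X r" and lc: "locally_compact_space X"
    and I: "I_space X r" and conv: "locally_order_convex X r"
  shows "regular_space X"
  unfolding neighbourhood_base_of_closedin[symmetric] neighbourhood_base_of
proof (intro allI impI)
  fix W x assume W: "openin X W \<and> x \<in> W"
  note r' = preorder_on_converse[THEN iffD2, OF r(1)] T2_preordered_converse[OF r(2)]
  obtain P where P: "openin X (r\<inverse> `` P)" "openin X (r `` P)" "x \<in> r\<inverse> `` P" "x \<in> r `` P"
      "r\<inverse> `` P \<inter> r `` P \<subseteq> W"
    using locally_order_convex_I_space_hull[OF r(1) I conv] W by metis
  obtain U N where N: "openin X U" "compactin X N" "x \<in> U" "U \<subseteq> N" "N \<subseteq> r `` P"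
    by (rule increasing_compact_neighbourhood[OF r lc P(2) increasing_set_Image[OF r(1)] P(4)])
  obtain U' M where M: "openin X U'" "compactin X M" "x \<in> U'" "U' \<subseteq> M" "M \<subseteq> r\<inverse> `` P"
    by (rule increasing_compact_neighbourhood[OF r' lc P(1) increasing_set_Image[OF r'(1)] P(3)])
  have "closedin X (r\<inverse> `` M \<inter> r `` N)"
    by (intro closedin_Int closedin_Image_compactin r r' N M)
  moreover have "U \<inter> U' \<subseteq> r\<inverse> `` M \<inter> r `` N"
    using preorder_on_subset_Image(1)[OF r(1) compactin_subset_topspace[OF N(2)]]
      preorder_on_subset_Image(1)[OF r'(1) compactin_subset_topspace[OF M(2)]] N(4) M(4) by blast
  moreover have "r\<inverse> `` M \<inter> r `` N \<subseteq> W"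
    using N(5) M(5) P(5) preorder_onD(3)[OF r(1)] by blast
  ultimately show "\<exists>U V. openin X U \<and> closedin X V \<and> x \<in> U \<and> U \<subseteq> V \<and> V \<subseteq> W"
    using openin_Int[OF N(1) M(1)] N(3) M(3) by (metis IntI)
qed

text \<open>
  An ordered version of the Urysohn lemma, obtained from the ordinary one: the isotone envelope
  \<open>f y = Sup {h z | z \<le> y}\<close> of a bump function \<open>h\<close> stays continuous when \<open>r\<close> has the \<open>I\<close>-property and
  \<open>h\<close> vanishes outside a compact set.
\<close>

lemma utility_exists:
  assumes r: "preorder_on (topspace X) r" "T2_preordered X r" and lc: "locally_compact_space X"
    and I: "I_space X r" and reg: "regular_space X"
    and V: "openin X V" "increasing_set r V" and x: "x \<in> V"
  obtains f where "utility_on X r f" "f x = 1" "\<And>y. y \<in> topspace X - V \<Longrightarrow> f y = 0"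
proof -
  let ?E = "topspace X"
  note pre = preorder_onD[OF r(1)]
  have VE: "V \<subseteq> ?E"
    by (rule openin_subset[OF V(1)])
  then have xE: "x \<in> ?E"
    using x by blast
  obtain W K where K: "openin X W" "compactin X K" "x \<in> W" "W \<subseteq> K"
    using lc xE unfolding locally_compact_space_def by metis
  have "completely_regular_space X"
    using lc reg by (blast intro: locally_compact_regular_imp_completely_regular_space)
  moreover have "closedin X (?E - W \<inter> V)"
    by (rule closedin_diff[OF closedin_topspace openin_Int[OF K(1) V(1)]])
  moreover have "x \<in> ?E - (?E - W \<inter> V)"
    using x xE K(3) by blast
  ultimately obtain g :: "'a \<Rightarrow> real" where g: "continuous_map X (top_of_set {0..1}) g" "g x = 0"
      and g1: "g ` (?E - W \<inter> V) \<subseteq> {1}"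
    unfolding completely_regular_space_def by metis
  \<comment> \<open>The bump: 1 at \<open>x\<close>, and 0 outside \<open>W \<inter> V\<close>, a part of the compact set \<open>K\<close>.\<close>
  define h where "h y = 1 - g y" for y
  have h01: "0 \<le> h y" "h y \<le> 1" if "y \<in> ?E" for y
    using g(1) that by (auto simp: h_def continuous_map_in_subtopology image_subset_iff Pi_iff)
  have h0: "h y = 0" if "y \<in> ?E" "y \<notin> W \<inter> V" for y
    using g1 that by (auto simp: h_def)
  have h_open: "openin X {y \<in> ?E. h y > a}" for a
  proof -
    have "{y \<in> ?E. h y > a} = {y \<in> ?E. g y < 1 - a}"
      by (auto simp: h_def)
    then show ?thesis
      using g(1) by (simp add: continuous_map_upper_lower_semicontinuous_lte_gen)
  qed
  have h_compact: "compactin X {y \<in> ?E. h y \<ge> b}" if "0 < b" for b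
  proof (rule closed_compactin[OF K(2)])
    have "{y \<in> ?E. h y \<ge> b} = {y \<in> ?E. g y \<le> 1 - b}"
      by (auto simp: h_def)
    then show "closedin X {y \<in> ?E. h y \<ge> b}"
      using g(1) by (simp add: continuous_map_upper_lower_semicontinuous_lte_gen)
    show "{y \<in> ?E. h y \<ge> b} \<subseteq> K"
      using h0 that K(4) by fastforce
  qed
  define f where "f y = Sup (h ` (r\<inverse> `` {y}))" for y
  have bdd: "bdd_above (h ` (r\<inverse> `` {y}))" for y
    using h01(2) pre(1) by (intro bdd_aboveI[of _ 1]) blast
  have ne: "h ` (r\<inverse> `` {y}) \<noteq> {}" if "y \<in> ?E" for y
    using pre(2)[OF that] by blast
  have h_le_f: "h z \<le> f y" if "(z, y) \<in> r" for z y
    unfolding f_def using that by (intro cSup_upper bdd) blast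
  have f_le: "f y \<le> c" if "y \<in> ?E" "\<And>z. (z, y) \<in> r \<Longrightarrow> h z \<le> c" for y c
    unfolding f_def using that by (intro cSup_least ne) blast+
  have less_f: "c < f y \<longleftrightarrow> (\<exists>z. (z, y) \<in> r \<and> c < h z)" if "y \<in> ?E" for y c
    unfolding f_def using less_cSup_iff[OF ne[OF that] bdd] by blast
  have f01: "0 \<le> f y \<and> f y \<le> 1" if "y \<in> ?E" for y
    using h01 that pre(1) h_le_f[OF pre(2)[OF that]] by (force intro: f_le)
  have f_open_gt: "openin X {y \<in> ?E. f y > a}" for a
  proof -
    have "{y \<in> ?E. f y > a} = r `` {z \<in> ?E. h z > a}"
      using less_f pre(1) by blast
    then show ?thesis
      using I h_open unfolding I_space_def by simp
  qed
  have f_closed_ge: "closedin X {y \<in> ?E. f y \<ge> a}" for a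
  proof (cases "a \<le> 0")
    case True
    then have "{y \<in> ?E. f y \<ge> a} = ?E"
      using f01 by force
    then show ?thesis
      by simp
  next
    case False
    \<comment> \<open>Levels \<open>b \<le> 0\<close> are left out: the sets \<open>{h \<ge> b}\<close> need not be compact for them.\<close>
    have "{y \<in> ?E. f y \<ge> a} = (\<Inter>b \<in> {0<..<a}. r `` {z \<in> ?E. h z \<ge> b})" (is "?L = ?R")
    proof (intro equalityI subsetI)
      fix y assume "y \<in> ?L"
      then have y: "y \<in> ?E" "f y \<ge> a"
        by auto
      have "y \<in> r `` {z \<in> ?E. h z \<ge> b}" if "b < a" for b
      proof -
        obtain z where "(z, y) \<in> r" "b < h z"
          using less_f[OF y(1), of b] y(2) \<open>b < a\<close> by auto
        then show ?thesis
          using pre(1) by force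
      qed
      then show "y \<in> ?R"
        by simp
    next
      fix y assume y: "y \<in> ?R"
      have *: "\<exists>z. (z, y) \<in> r \<and> h z \<ge> b" if "0 < b" "b < a" for b
        using y that by fastforce
      have yE: "y \<in> ?E"
        using *[of "a / 2"] False pre(1) by auto
      have "b \<le> f y" if "0 < b" "b < a" for b
        using *[OF that] h_le_f by force
      then have "a \<le> f y"
        using False by (intro dense_ge_bounded[of 0] dense_le_bounded[of 0 a]) auto
      with yE show "y \<in> ?L"
        by simp
    qed
    moreover have "closedin X ?R"
      using False
      by (intro closedin_INT closedin_Image_compactin r h_compact) auto
    ultimately show ?thesis
      by simp
  qed
  have f_open_lt: "openin X {y \<in> ?E. f y < a}" for a
  proof -
    have "{y \<in> ?E. f y < a} = ?E - {y \<in> ?E. f y \<ge> a}"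
      by auto
    then show ?thesis
      using openin_diff[OF openin_topspace f_closed_ge] by simp
  qed
  have "f u \<le> f v" if "(u, v) \<in> r" for u v
    using that pre(1,3) by (blast intro: f_le h_le_f)
  then have "utility_on X r f"
    using f01 f_open_gt f_open_lt
    by (auto simp: utility_on_def continuous_map_upper_lower_semicontinuous_lt_gen)
  moreover have "f x = 1"
    using h_le_f[OF pre(2)[OF xE]] f01[OF xE] g(2) by (simp add: h_def)
  moreover have "f y = 0" if y: "y \<in> ?E - V" for y
  proof -
    have "h z \<le> 0" if "(z, y) \<in> r" for z
      using h0[of z] that y V(2) pre(1) unfolding increasing_set_def by fastforce
    then show ?thesis
      using f_le[of y 0] f01[of y] y by force
  qed
  ultimately show thesis
    using that by blast
qed

text \<open>
  For each pair of basic open sets \<open>A\<close> and \<open>B\<close>, one utility is chosen that exceeds \<open>1/2\<close> on \<open>A\<close> and vanishes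
  off \<open>i(B)\<close>, if there is any.  This suffices because the hulls \<open>i(B)\<close> form a base of the upper topology and
  a utility with value 1 at \<open>x\<close> exceeds \<open>1/2\<close> on a basic neighbourhood of \<open>x\<close>.
\<close>

lemma countable_separating_utilities:
  assumes r: "preorder_on (topspace X) r" "T2_preordered X r" and lc: "locally_compact_space X"
    and I: "I_space X r" and reg: "regular_space X" and sc: "second_countable X"
  obtains F where "countable F" "\<And>f. f \<in> F \<Longrightarrow> utility_on X r f"
    "\<And>V x. openin X V \<Longrightarrow> increasing_set r V \<Longrightarrow> x \<in> V \<Longrightarrow>
       \<exists>f\<in>F. 1/2 < f x \<and> (\<forall>y \<in> topspace X - V. f y = 0)"
proof -
  obtain \<B> where \<B>: "countable \<B>" "\<And>B. B \<in> \<B> \<Longrightarrow> openin X B"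
      and base: "\<And>U x. openin X U \<and> x \<in> U \<longrightarrow> (\<exists>B\<in>\<B>. x \<in> B \<and> B \<subseteq> U)"
    using sc unfolding second_countable_def by blast
  define Q where "Q = (\<lambda>(A, B) f. utility_on X r f \<and> (\<forall>y\<in>A. 1/2 < f y) \<and>
    (\<forall>y \<in> topspace X - r `` B. f y = 0))"
  define F where "F = (\<lambda>AB. SOME f. Q AB f) ` {AB \<in> \<B> \<times> \<B>. \<exists>f. Q AB f}"
  have Q: "Q AB (SOME f. Q AB f)" if "\<exists>f. Q AB f" for AB
    using that by (rule someI_ex)
  show thesis
  proof
    have "countable (\<B> \<times> \<B>)"
      using \<B>(1) by simp
    then show "countable F"
      unfolding F_def by (intro countable_image) (rule countable_subset[rotated], auto)
    show "utility_on X r f" if f: "f \<in> F" for f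
    proof -
      obtain AB where "f = (SOME f. Q AB f)" "\<exists>f. Q AB f"
        using f unfolding F_def by blast
      then have "Q AB f"
        using Q by metis
      then show ?thesis
        by (auto simp: Q_def split: prod.splits)
    qed
    fix V x assume V: "openin X V" "increasing_set r V" and x: "x \<in> V"
    obtain B where B: "B \<in> \<B>" "x \<in> B" "B \<subseteq> V"
      using base V(1) x by metis
    have BV: "r `` B \<subseteq> V"
      using B(3) V(2) unfolding increasing_set_def by blast
    have BE: "B \<subseteq> topspace X"
      by (rule openin_subset[OF \<B>(2)[OF B(1)]])
    have rB: "openin X (r `` B)"
      using I \<B>(2)[OF B(1)] unfolding I_space_def by blast
    have xB: "x \<in> r `` B"
      using B(2) preorder_on_subset_Image(1)[OF r(1) BE] by blast
    have "\<exists>f. utility_on X r f \<and> f x = 1 \<and> (\<forall>y \<in> topspace X - r `` B. f y = 0)"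
      by (rule utility_exists[OF r lc I reg rB increasing_set_Image[OF r(1)] xB]) blast
    then obtain f where f: "utility_on X r f" "f x = 1" "\<forall>y \<in> topspace X - r `` B. f y = 0"
      by blast
    have fx: "x \<in> {y \<in> topspace X. f y > 1/2}"
      using f(2) B(2) BE by auto
    obtain A where A: "A \<in> \<B>" "x \<in> A" "A \<subseteq> {y \<in> topspace X. f y > 1/2}"
      using base[rule_format, OF conjI[OF openin_utility_gt[OF f(1)] fx]] by blast
    have ex: "\<exists>f. Q (A, B) f"
      using f(1,3) A(3) by (auto simp: Q_def)
    define g where "g = (SOME f. Q (A, B) f)"
    have "g \<in> F"
      unfolding F_def g_def using A(1) B(1) ex by (intro imageI) simp
    moreover have "\<forall>y\<in>A. 1/2 < g y" "\<forall>y \<in> topspace X - r `` B. g y = 0"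
      using Q[OF ex, folded g_def] by (simp_all add: Q_def)
    ultimately show "\<exists>f\<in>F. 1/2 < f x \<and> (\<forall>y \<in> topspace X - V. f y = 0)"
      using A(2) BV by blast
  qed
qed


section \<open>The quasi-pseudo-metric of a sequence of utilities\<close>

text \<open>
  A weighted supremum in place of the customary series: it gives the same topologies, and comparing it with
  a bound comes down to comparing each term.
\<close>

definition utility_qpm :: "(nat \<Rightarrow> 'a \<Rightarrow> real) \<Rightarrow> 'a \<Rightarrow> 'a \<Rightarrow> real" where
  "utility_qpm f x y = (SUP n. max 0 (f n x - f n y) / 2 ^ n)"

text \<open>
  By this symmetry the lower topology needs no argument of its own: it is the upper topology of the opposite
  preorder, for which the reflected functions are utilities.
\<close>

lemma qpm_conjugate_utility_qpm:
  "qpm_conjugate (utility_qpm f) = utility_qpm (\<lambda>n x. 1 - f n x)"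
  by (simp add: qpm_conjugate_def utility_qpm_def fun_eq_iff)

lemma utility_qpm_le:
  assumes "\<And>n. max 0 (f n x - f n y) / 2 ^ n \<le> c"
  shows "utility_qpm f x y \<le> c"
  unfolding utility_qpm_def using assms by (intro cSUP_least) auto

lemma le_utility_qpm:
  assumes "\<And>n. utility_on X r (f n)" "x \<in> topspace X" "y \<in> topspace X"
  shows "max 0 (f n x - f n y) / 2 ^ n \<le> utility_qpm f x y"
  unfolding utility_qpm_def
proof (rule cSUP_upper)
  show "bdd_above (range (\<lambda>n. max 0 (f n x - f n y) / 2 ^ n))"
  proof (rule bdd_aboveI[of _ 1], clarify)
    fix n
    have "max 0 (f n x - f n y) \<le> 1"
      using utility_on_range[OF assms(1)[of n] assms(2)]
        utility_on_range[OF assms(1)[of n] assms(3)] by linarith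
    also have "\<dots> \<le> 2 ^ n"
      by simp
    finally show "max 0 (f n x - f n y) / 2 ^ n \<le> 1"
      by simp
  qed
qed simp

lemma quasi_pseudo_metric_on_utility_qpm:
  assumes f: "\<And>n. utility_on X r (f n)"
  shows "quasi_pseudo_metric_on (topspace X) (utility_qpm f)"
  unfolding quasi_pseudo_metric_on_def
proof (intro conjI ballI)
  note le = le_utility_qpm[of X r f, OF f]
  show nonneg: "0 \<le> utility_qpm f x y" if "x \<in> topspace X" "y \<in> topspace X" for x y
    using le[OF that, of 0] by simp
  show "utility_qpm f x x = 0" if "x \<in> topspace X" for x
    using nonneg[OF that that] utility_qpm_le[of f x x 0] by simp
  show "utility_qpm f x z \<le> utility_qpm f x y + utility_qpm f y z"
    if x: "x \<in> topspace X" and y: "y \<in> topspace X" and z: "z \<in> topspace X" for x y z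
  proof (rule utility_qpm_le)
    fix n
    have "max 0 (f n x - f n z) \<le> max 0 (f n x - f n y) + max 0 (f n y - f n z)"
      by simp
    then have "max 0 (f n x - f n z) / 2 ^ n
        \<le> max 0 (f n x - f n y) / 2 ^ n + max 0 (f n y - f n z) / 2 ^ n"
      by (simp add: divide_right_mono flip: add_divide_distrib)
    also have "\<dots> \<le> utility_qpm f x y + utility_qpm f y z"
      by (intro add_mono le x y z)
    finally show "max 0 (f n x - f n z) / 2 ^ n \<le> utility_qpm f x y + utility_qpm f y z" .
  qed
qed

text \<open>
  Only finitely many utilities matter up to \<open>e / 2\<close>, because of the weights \<open>2\<^sup>-\<^sup>n\<close>, and for each of them
  the points where it has not dropped by \<open>e / 2\<close> form an open increasing set.
\<close>

lemma upper_neighbourhood_in_utility_qpm_ball: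
  assumes r: "preorder_on (topspace X) r" and f: "\<And>n. utility_on X r (f n)"
    and z: "z \<in> topspace X" and e: "0 < e"
  obtains N where "openin X N" "increasing_set r N" "z \<in> N"
    "N \<subseteq> qpm_ball (topspace X) (utility_qpm f) z e"
proof -
  obtain M where M: "(1/2) ^ M < e / 2"
    using e real_arch_pow_inv[of "e/2" "1/2"] by auto
  define N where "N = topspace X \<inter> (\<Inter>n\<in>{..<M}. {y \<in> topspace X. f n y > f n z - e / 2})"
  show thesis
  proof
    show "openin X N"
    proof (cases "M = 0")
      case False
      then show ?thesis
        unfolding N_def
        by (intro openin_Int openin_topspace openin_INT2 openin_utility_gt[OF f]) auto
    qed (simp add: N_def)
    have "\<forall>x\<in>N. \<forall>y. (x, y) \<in> r \<longrightarrow> y \<in> N"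
    proof (intro ballI allI impI)
      fix x y assume xy: "x \<in> N" "(x, y) \<in> r"
      then have "f n x \<le> f n y" for n
        using f[of n] unfolding utility_on_def by blast
      with xy preorder_onD(1)[OF r] show "y \<in> N"
        unfolding N_def by (auto intro: less_le_trans)
    qed
    moreover have "N \<subseteq> topspace X"
      unfolding N_def by blast
    ultimately show "increasing_set r N"
      by (rule increasing_set_iff[OF r, THEN iffD2, rotated])
    show "z \<in> N"
      using z e by (simp add: N_def)
    show "N \<subseteq> qpm_ball (topspace X) (utility_qpm f) z e"
    proof
      fix y assume y: "y \<in> N"
      then have yE: "y \<in> topspace X"
        by (simp add: N_def)
      have "max 0 (f n z - f n y) / 2 ^ n \<le> e / 2" for n
      proof (cases "n < M")
        case True
        then have "f n z - e / 2 < f n y"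
          using y by (simp add: N_def)
        then have "max 0 (f n z - f n y) \<le> e / 2"
          using e by linarith
        moreover have "max 0 (f n z - f n y) / 2 ^ n \<le> max 0 (f n z - f n y)"
          using divide_left_mono[of 1 "2 ^ n" "max 0 (f n z - f n y)"] by simp
        ultimately show ?thesis
          by (rule order_trans[rotated])
      next
        case False
        have "max 0 (f n z - f n y) \<le> 1"
          using utility_on_range[OF f[of n] yE] utility_on_range[OF f[of n] z] by linarith
        then have "max 0 (f n z - f n y) / 2 ^ n \<le> (1/2) ^ n"
          by (simp add: power_divide divide_right_mono)
        also have "\<dots> \<le> (1/2) ^ M"
          using False by (intro power_decreasing) auto
        also have "\<dots> \<le> e / 2"
          using M by simp
        finally show ?thesis .
      qed
      then have "utility_qpm f z y \<le> e / 2"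
        by (rule utility_qpm_le)
      then show "y \<in> qpm_ball (topspace X) (utility_qpm f) z e"
        using yE e by (simp add: qpm_ball_def)
    qed
  qed
qed

text \<open>
  Balls are open in the upper topology by continuity of the utilities; conversely, a drop of
  \<open>f n\<close> by at least \<open>e\<close> on leaving \<open>V\<close> keeps the ball of radius \<open>e / 2 ^ n\<close> within \<open>V\<close>.
\<close>

lemma qpm_topology_utility_qpm:
  assumes r: "preorder_on (topspace X) r" and f: "\<And>n. utility_on X r (f n)"
    and sep: "\<And>V x. openin X V \<Longrightarrow> increasing_set r V \<Longrightarrow> x \<in> V \<Longrightarrow>
      \<exists>n. \<exists>e>0. \<forall>y \<in> topspace X - V. f n y \<le> f n x - e"
  shows "qpm_topology (topspace X) (utility_qpm f) = upper_topology X r"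
proof -
  let ?E = "topspace X" and ?p = "utility_qpm f"
  let ?P = "\<lambda>B. \<exists>x\<in>?E. \<exists>e>0. B = qpm_ball ?E ?p x e"
  note qpm = quasi_pseudo_metric_on_utility_qpm[of X r f, OF f]
  have tri: "?p x y \<le> ?p x z + ?p z y" if "x \<in> ?E" "y \<in> ?E" "z \<in> ?E" for x y z
    using qpm that unfolding quasi_pseudo_metric_on_def by blast
  have refl: "?p x x = 0" if "x \<in> ?E" for x
    using qpm that unfolding quasi_pseudo_metric_on_def by blast
  have ball: "openin (upper_topology X r) (qpm_ball ?E ?p x e)" if x: "x \<in> ?E" for x e
  proof (subst openin_subopen, intro ballI)
    fix z assume "z \<in> qpm_ball ?E ?p x e"
    then have z: "z \<in> ?E" "0 < e - ?p x z"
      by (auto simp: qpm_ball_def)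
    obtain N where N: "openin X N" "increasing_set r N" "z \<in> N"
        "N \<subseteq> qpm_ball ?E ?p z (e - ?p x z)"
      by (rule upper_neighbourhood_in_utility_qpm_ball[OF r f z])
    have "qpm_ball ?E ?p z (e - ?p x z) \<subseteq> qpm_ball ?E ?p x e"
      using tri x z(1) by (fastforce simp: qpm_ball_def)
    with N show "\<exists>T. openin (upper_topology X r) T \<and> z \<in> T \<and> T \<subseteq> qpm_ball ?E ?p x e"
      using openin_upper_topology[OF r] by (meson subset_trans)
  qed
  have upper: "\<exists>B. ?P B \<and> x \<in> B \<and> B \<subseteq> V"
    if V: "openin X V" "increasing_set r V" and x: "x \<in> V" for V x
  proof -
    have xE: "x \<in> ?E"
      using openin_subset[OF V(1)] x by blast
    obtain n e where e: "0 < e" and sep: "\<And>y. y \<in> ?E - V \<Longrightarrow> f n y \<le> f n x - e"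
      using sep[OF V x] by blast
    have "y \<in> V" if y: "y \<in> ?E" "?p x y < e / 2 ^ n" for y
    proof (rule ccontr)
      assume "y \<notin> V"
      then have "e \<le> max 0 (f n x - f n y)"
        using sep[of y] y(1) by simp
      then have "e / 2 ^ n \<le> max 0 (f n x - f n y) / 2 ^ n"
        by (intro divide_right_mono) auto
      also have "\<dots> \<le> ?p x y"
        by (rule le_utility_qpm[of X r f, OF f xE y(1)])
      finally show False
        using y(2) by simp
    qed
    then have "qpm_ball ?E ?p x (e / 2 ^ n) \<subseteq> V"
      by (auto simp: qpm_ball_def)
    moreover have "x \<in> qpm_ball ?E ?p x (e / 2 ^ n)" "0 < e / 2 ^ n"
      using xE e refl by (simp_all add: qpm_ball_def)
    ultimately show ?thesis
      using xE by blast
  qed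
  have "openin (qpm_topology ?E ?p) U \<longleftrightarrow> openin (upper_topology X r) U" for U
  proof
    assume "openin (qpm_topology ?E ?p) U"
    then obtain \<U> where \<U>: "\<U> \<subseteq> Collect ?P" "\<Union>\<U> = U"
      unfolding openin_qpm_topology[OF qpm] union_of_def by blast
    have "openin (upper_topology X r) B" if "B \<in> \<U>" for B
      using \<U>(1) that ball by auto
    then show "openin (upper_topology X r) U"
      unfolding \<U>(2)[symmetric] by (rule openin_Union)
  next
    assume "openin (upper_topology X r) U"
    then have U: "openin X U" "increasing_set r U"
      using openin_upper_topology[OF r] by blast+
    show "openin (qpm_topology ?E ?p) U"
      unfolding openin_qpm_topology[OF qpm] arbitrary_union_of_alt
      using upper[OF U] by blast
  qed
  then show ?thesis
    by (simp add: topology_eq)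
qed

lemma lower_topology_eq_upper_converse: "lower_topology X r = upper_topology X (r\<inverse>)"
  by (simp add: lower_topology_def upper_topology_def decreasing_set_eq_increasing_converse)

lemma I_space_imp_strictly_quasi_pseudo_metrizable:
  assumes r: "preorder_on (topspace X) r" "T2_preordered X r" and lc: "locally_compact_space X"
    and sc: "second_countable X" and I: "I_space X r" and conv: "locally_order_convex X r"
  shows "strictly_quasi_pseudo_metrizable X r"
proof -
  note reg = I_space_imp_regular_space[OF r lc I conv]
  note r' = preorder_on_converse[THEN iffD2, OF r(1)] T2_preordered_converse[OF r(2)]
  have I': "I_space X (r\<inverse>)"
    using I by (auto simp: I_space_def)
  obtain F where F: "countable F" "\<And>f. f \<in> F \<Longrightarrow> utility_on X r f"
    "\<And>V x. openin X V \<Longrightarrow> increasing_set r V \<Longrightarrow> x \<in> V \<Longrightarrow>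
       \<exists>f\<in>F. 1/2 < f x \<and> (\<forall>y \<in> topspace X - V. f y = 0)"
    using countable_separating_utilities[OF r lc I reg sc] by metis
  obtain G where G: "countable G" "\<And>f. f \<in> G \<Longrightarrow> utility_on X (r\<inverse>) f"
    "\<And>V x. openin X V \<Longrightarrow> increasing_set (r\<inverse>) V \<Longrightarrow> x \<in> V \<Longrightarrow>
       \<exists>f\<in>G. 1/2 < f x \<and> (\<forall>y \<in> topspace X - V. f y = 0)"
    using countable_separating_utilities[OF r' lc I' reg sc] by metis
  \<comment> \<open>The zero function only ensures that there is something to enumerate, even if \<open>X\<close> is empty.\<close>
  define H where "H = insert (\<lambda>_. 0) (F \<union> (\<lambda>g x. 1 - g x) ` G)"
  have "countable H" "H \<noteq> {}"
    unfolding H_def using F(1) G(1) by auto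
  then obtain f :: "nat \<Rightarrow> 'a \<Rightarrow> real" where f: "range f = H"
    using range_from_nat_into by metis
  have "utility_on X r (\<lambda>_. 0)"
    by (simp add: utility_on_def continuous_map_in_subtopology)
  then have "utility_on X r h" if "h \<in> H" for h
    using that F(2) utility_on_reflect[OF G(2)] unfolding H_def by auto
  then have util: "utility_on X r (f n)" for n
    using f by blast
  have "\<exists>n. \<exists>e>0. \<forall>y \<in> topspace X - V. f n y \<le> f n x - e"
    if V: "openin X V" "increasing_set r V" "x \<in> V" for V x
  proof -
    obtain h where h: "h \<in> F" "1/2 < h x" "\<And>y. y \<in> topspace X - V \<Longrightarrow> h y = 0"
      using F(3)[OF V] by blast
    have "h \<in> range f"
      using h(1) by (simp add: f H_def)
    then obtain n where "h = f n"
      by blast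
    with h show ?thesis
      by (intro exI[of _ n] exI[of _ "1/2"]) auto
  qed
  then have upper: "qpm_topology (topspace X) (utility_qpm f) = upper_topology X r"
    by (rule qpm_topology_utility_qpm[OF r(1) util])
  have "\<exists>n. \<exists>e>0. \<forall>y \<in> topspace X - V. 1 - f n y \<le> 1 - f n x - e"
    if V: "openin X V" "increasing_set (r\<inverse>) V" "x \<in> V" for V x
  proof -
    obtain h where h: "h \<in> G" "1/2 < h x" "\<And>y. y \<in> topspace X - V \<Longrightarrow> h y = 0"
      using G(3)[OF V] by blast
    have "(\<lambda>x. 1 - h x) \<in> range f"
      using h(1) by (simp add: f H_def)
    then obtain n where "(\<lambda>x. 1 - h x) = f n"
      by (rule rangeE)
    then have "f n y = 1 - h y" for y
      by metis
    with h show ?thesis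
      by (intro exI[of _ n] exI[of _ "1/2"]) auto
  qed
  then have "qpm_topology (topspace X) (qpm_conjugate (utility_qpm f)) = lower_topology X r"
    unfolding qpm_conjugate_utility_qpm lower_topology_eq_upper_converse
    by (rule qpm_topology_utility_qpm[OF r'(1) utility_on_reflect[OF util]])
  with upper show ?thesis
    unfolding strictly_quasi_pseudo_metrizable_def
    using I_space_imp_order_convex_space[OF r(1) I conv] T2_preordered_imp_semiclosed[OF r]
      quasi_pseudo_metric_on_utility_qpm[of X r f, OF util] by blast
qed

theorem theorem5p3:
  fixes X :: "'a topology" and r :: "'a rel"
  assumes "preorder_on (topspace X) r"
    and "second_countable X"
    and "locally_compact_space X"
    and "T2_preordered X r"
  shows "(locally_order_convex X r \<and> I_space X r \<longrightarrow> strictly_quasi_pseudo_metrizable X r) \<and>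
         ((k_preserving X r \<or> compactly_generated_preorder X r) \<and> antisym r \<longrightarrow>
            locally_order_convex X r)"
  using assms I_space_imp_strictly_quasi_pseudo_metrizable k_preserving_imp_locally_order_convex
    compactly_generated_imp_locally_order_convex by metis

end
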